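(* Let $0<a<b$ be real numbers. For an urn process $(X_n,Y_n)_{n\ge0}$ with parameters $a,b$ (as defined in the context) started from $(X_0,Y_0)$ with $M=X_0+Y_0$ and $0<X_0<M$, define for integers $0\le n<M/a$ $$L_n=\frac{Y_n}{(M-an)-X_0(1-an/M)^{b/a}},$$ and for $\varepsilon>0$ the event $$\mathbf{L}_{X_0,M,\varepsilon}=\{|L_n-1|\le\varepsilon \text{ for all integers } 0\le n<M/a\}.$$ Then for every $\varepsilon>0$ there is a family of positive numbers $(\lambda_{\varepsilon,M})_M$, indexed by the possible values of $M$ (and depending, besides $\varepsilon$ and $M$, only on $a$ and $b$), with $\lambda_{\varepsilon,M}\to0$ as $M\to\infty$, such that for all $M$ and all starting configurations with $0<X_0<M$ (and $Y_0=M-X_0$), $$\mathbb{P}(\mathbf{L}_{X_0,M,\varepsilon})\ge 1-\lambda_{\varepsilon,M}.$$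
   Context: Urn process. Fix real numbers $0<a<b$. The initial configuration is $(X_0,Y_0)$ with $X_0>0$ a (deterministic) positive integer multiple of $b$ and $Y_0\ge 0$ a deterministic real number; put $M=X_0+Y_0$. The urn process with parameters $a,b$ (replacement matrix $\begin{pmatrix}-b & b-a\\ 0&-a\end{pmatrix}$) is the Markov chain $(X_n,Y_n)_{n\ge0}$ with transition probabilities, as long as the process has not stopped, $$\mathbb{P}(X_{n+1}=X_n-b,\ Y_{n+1}=Y_n+b-a)=\frac{X_n}{X_n+Y_n},\qquad \mathbb{P}(X_{n+1}=X_n,\ Y_{n+1}=Y_n-a)=\frac{Y_n}{X_n+Y_n}$$ (conditionally on the first $n$ steps). The process stops at the random time $\rho$, the first time $n$ such that $X_n<0$ or $Y_n<0$ or $X_n+Y_n=M-an\le 0$; for $n\ge\rho$ one sets $X_n=X_\rho$, $Y_n=Y_\rho$. (Before stopping, $X_n+Y_n=M-an$; since $X_0$ is a multiple of $b$, $X_n$ never becomes negative.) $X_n$ and $Y_n$ are thought of as the numbers of blue and red balls. *)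

theory Defs
  imports "HOL-Probability.Probability"
begin

text \<open>States are pairs \<open>(x, y)\<close> (blue, red). The urn process is the process stopped at the first
  time it hits a stopped state, i.e. stopped states are absorbing. In the other states
  \<open>x / (x + y)\<close> lies in \<open>[0, 1]\<close>, so \<open>bernoulli_pmf\<close> does not truncate its parameter.\<close>

definition urn_stopped :: "real \<times> real \<Rightarrow> bool" where
  "urn_stopped = (\<lambda>(x, y). x < 0 \<or> y < 0 \<or> x + y \<le> 0)"

definition urn_step :: "real \<Rightarrow> real \<Rightarrow> real \<times> real \<Rightarrow> (real \<times> real) pmf" where
  "urn_step a b = (\<lambda>(x, y).
     if urn_stopped (x, y) then return_pmf (x, y)
     else map_pmf (\<lambda>blue. if blue then (x - b, y + b - a) else (x, y - a))
            (bernoulli_pmf (x / (x + y))))"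

lemma pmf_urn_step:
  assumes "b \<noteq> 0" "\<not> urn_stopped (x, y)"
  shows "pmf (urn_step a b (x, y)) (x - b, y + b - a) = x / (x + y)"
    and "pmf (urn_step a b (x, y)) (x, y - a) = y / (x + y)"
proof -
  have pos: "0 \<le> x" "0 \<le> y" "0 < x + y"
    using assms(2) by (auto simp: urn_stopped_def)
  let ?f = "\<lambda>blue. if blue then (x - b, y + b - a) else (x, y - a)"
  have inj: "inj ?f"
    using assms(1) by (auto simp: inj_def)
  have "pmf (map_pmf ?f (bernoulli_pmf (x / (x + y)))) (?f c) =
      pmf (bernoulli_pmf (x / (x + y))) c" for c
    by (rule pmf_map_inj'[OF inj])
  from this[of True] this[of False]
  show "pmf (urn_step a b (x, y)) (x - b, y + b - a) = x / (x + y)"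
    and "pmf (urn_step a b (x, y)) (x, y - a) = y / (x + y)"
    using assms(2) pos by (auto simp: urn_step_def field_simps)
qed

text \<open>The law of the urn process on its space of trajectories, by the Ionescu-Tulcea theorem.
  \<open>urn_kernel a b s n \<omega>\<close> is the conditional law of the state at time \<open>n\<close> given the
  states \<open>\<omega> 0, \<dots>, \<omega> (n - 1)\<close>. Each state space is discrete, so the sigma-algebra
  on trajectories is the product of the power sets; the lemmas after the definition
  give the Markov property.\<close>

definition urn_kernel ::
    "real \<Rightarrow> real \<Rightarrow> real \<times> real \<Rightarrow> nat \<Rightarrow> (nat \<Rightarrow> real \<times> real) \<Rightarrow> (real \<times> real) measure" where
  "urn_kernel a b s n \<omega> =
     measure_pmf (case n of 0 \<Rightarrow> return_pmf s | Suc m \<Rightarrow> urn_step a b (\<omega> m))"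

global_interpretation urn: Ionescu_Tulcea "urn_kernel a b s" "\<lambda>_. count_space UNIV" for a b s
proof (rule Ionescu_Tulcea.intro)
  fix i
  show "urn_kernel a b s i \<in> measurable (PiM {0..<i} (\<lambda>_. count_space UNIV))
          (subprob_algebra (count_space UNIV))"
  proof (cases i)
    case 0
    show ?thesis
      unfolding 0 urn_kernel_def
      by (auto intro!: measurable_const simp: space_subprob_algebra measure_pmf.subprob_space_axioms)
  next
    case (Suc m)
    have "(\<lambda>t. measure_pmf (urn_step a b t)) \<in>
        measurable (count_space UNIV) (subprob_algebra (count_space UNIV))"
      by (auto simp: space_subprob_algebra measure_pmf.subprob_space_axioms)
    moreover have "(\<lambda>\<omega>. \<omega> m) \<in> measurable (PiM {0..<i} (\<lambda>_. count_space UNIV)) (count_space UNIV)"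
      using Suc by (intro measurable_component_singleton) auto
    ultimately have "(\<lambda>\<omega>. measure_pmf (urn_step a b (\<omega> m))) \<in>
        measurable (PiM {0..<i} (\<lambda>_. count_space UNIV)) (subprob_algebra (count_space UNIV))"
      by (rule measurable_compose[rotated])
    then show ?thesis
      by (simp add: urn_kernel_def [abs_def] Suc)
  qed
next
  fix i x
  show "prob_space (urn_kernel a b s i x)"
    by (simp add: urn_kernel_def prob_space_measure_pmf)
qed

definition urn_law :: "real \<Rightarrow> real \<Rightarrow> real \<times> real \<Rightarrow> (nat \<Rightarrow> real \<times> real) measure" where
  "urn_law a b s = urn.PF.lim a b s"

lemma sets_urn_law [measurable_cong]:
  "sets (urn_law a b s) = sets (PiM UNIV (\<lambda>_. count_space UNIV))"
  by (simp add: urn_law_def)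

lemma space_urn_law [simp]: "space (urn_law a b s) = UNIV"
  by (simp add: urn_law_def space_PiM)

lemma emeasure_urn_law_emb:
  assumes "A \<in> sets (PiM {0..<n} (\<lambda>_. count_space UNIV))"
  shows "emeasure (urn_law a b s) {\<omega>. restrict \<omega> {0..<n} \<in> A} =
         emeasure (urn.C a b s 0 n (\<lambda>_. undefined)) A"
proof -
  have "{\<omega>. restrict \<omega> {0..<n} \<in> A} = prod_emb UNIV (\<lambda>_. count_space UNIV) {0..<n} A"
    by (auto simp: prod_emb_def)
  then have "emeasure (urn_law a b s) {\<omega>. restrict \<omega> {0..<n} \<in> A} = emeasure (urn.CI a b s {0..<n}) A"
    unfolding urn_law_def using urn.lim[of "{0..<n}" A a b s] assms by simp
  also have "\<dots> = emeasure (urn.C a b s 0 n (\<lambda>_. undefined))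
      (prod_emb {0..<n} (\<lambda>_. count_space UNIV) {0..<n} A)"
    by (rule urn.emeasure_CI) (use assms in auto)
  also have "prod_emb {0..<n} (\<lambda>_. count_space UNIV) {0..<n} A = A"
    using sets.sets_into_space[OF assms] by (intro prod_emb_id) (simp add: space_PiM)
  finally show ?thesis .
qed

lemma prob_space_urn_law: "prob_space (urn_law a b s)"
proof
  have "emeasure (urn_law a b s) (space (urn_law a b s)) =
      emeasure (urn_law a b s) {\<omega>. restrict \<omega> {0..<0::nat} \<in> space (PiM {0..<0} (\<lambda>_. count_space UNIV))}"
    by (rule arg_cong2[where f=emeasure]) (auto simp: space_PiM)
  also have "\<dots> = 1"
    using prob_space.emeasure_space_1[OF urn.prob_space_C[of "\<lambda>_. undefined" 0 a b s 0]]
    by (subst emeasure_urn_law_emb[OF sets.top]) (simp add: space_PiM)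
  finally show "emeasure (urn_law a b s) (space (urn_law a b s)) = 1" .
qed

lemma emeasure_urn_law_Suc:
  "emeasure (urn_law a b s) {\<omega>. \<forall>i<Suc n. \<omega> i = h i} =
   emeasure (urn_law a b s) {\<omega>. \<forall>i<n. \<omega> i = h i} * emeasure (urn_kernel a b s n h) {h n}"
proof -
  let ?S = "\<lambda>n. PiM {0..<n} (\<lambda>_::nat. count_space (UNIV :: (real \<times> real) set))"
  let ?C = "\<lambda>n. urn.C a b s 0 n (\<lambda>_. undefined)"
  let ?H = "\<lambda>n. {restrict h {0..<n}} :: (nat \<Rightarrow> real \<times> real) set"
  have H: "?H n \<in> sets (?S n)" for n
  proof -
    have "?H n = PiE {0..<n} (\<lambda>i. {h i})"
      using PiE_singleton[of "restrict h {0..<n}" "{0..<n}"]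
      by (subst PiE_cong[of _ _ "\<lambda>i. {restrict h {0..<n} i}"]) auto
    then show ?thesis by (simp add: sets_PiM_I_finite)
  qed
  have eq: "{\<omega>. \<forall>i<n. \<omega> i = h i} = {\<omega>. restrict \<omega> {0..<n} \<in> ?H n}" for n
    by (auto simp: restrict_def fun_eq_iff)
  have C: "emeasure (urn_law a b s) {\<omega>. \<forall>i<n. \<omega> i = h i} = emeasure (?C n) (?H n)" for n
    unfolding eq by (rule emeasure_urn_law_emb[OF H])
  have space: "\<omega> \<in> space (?S n)" if "\<omega> \<in> space (?C n)" for \<omega>
    using that urn.space_C[of "\<lambda>_. undefined" 0 a b s n] by simp
  have sets_Cn: "sets (?C n) = sets (?S n)"
    using urn.sets_C[of "\<lambda>_. undefined" 0 a b s n] by simp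
  have "emeasure (?C (Suc n)) (?H (Suc n)) = emeasure (?C n \<bind> urn.eP a b s n) (?H (Suc n))"
    by simp
  also have "\<dots> = (\<integral>\<^sup>+\<omega>. emeasure (urn.eP a b s n \<omega>) (?H (Suc n)) \<partial>?C n)"
  proof (rule emeasure_bind[OF _ _ H])
    show "space (?C n) \<noteq> {}"
      using urn.prob_space_C[of "\<lambda>_. undefined" 0 a b s n] by (simp add: prob_space.not_empty)
    show "urn.eP a b s n \<in> measurable (?C n) (subprob_algebra (?S (Suc n)))"
      using urn.measurable_eP[of a b s n] measurable_cong_sets[OF sets_Cn refl] by blast
  qed
  also have "\<dots> = (\<integral>\<^sup>+\<omega>. emeasure (urn_kernel a b s n h) {h n} * indicator (?H n) \<omega> \<partial>?C n)"
  proof (rule nn_integral_cong)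
    fix \<omega> assume "\<omega> \<in> space (?C n)"
    then have \<omega>: "\<omega> \<in> space (?S n)" by (rule space)
    then have ext: "\<omega> \<in> extensional {0..<n}" by (auto simp: space_PiM PiE_def)
    have upd: "fun_upd \<omega> n x = restrict h {0..<Suc n} \<longleftrightarrow> \<omega> = restrict h {0..<n} \<and> x = h n" for x
    proof
      assume *: "fun_upd \<omega> n x = restrict h {0..<Suc n}"
      have "\<omega> i = restrict h {0..<n} i" for i
        using fun_cong[OF *, of i] ext
        by (cases "i = n") (auto simp: restrict_def extensional_def split: if_splits)
      then show "\<omega> = restrict h {0..<n} \<and> x = h n"
        using fun_cong[OF *, of n] by auto
    qed (auto simp: restrict_def fun_eq_iff)
    have "emeasure (urn.eP a b s n \<omega>) (?H (Suc n)) =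
        emeasure (urn_kernel a b s n \<omega>) {x. \<omega> = restrict h {0..<n} \<and> x = h n}"
      by (subst urn.emeasure_eP[OF \<omega> H]) (simp add: vimage_def upd)
    also have "\<dots> = emeasure (urn_kernel a b s n h) {h n} * indicator (?H n) \<omega>"
      by (cases "\<omega> = restrict h {0..<n}") (auto simp: urn_kernel_def split: nat.split)
    finally show "emeasure (urn.eP a b s n \<omega>) (?H (Suc n)) =
        emeasure (urn_kernel a b s n h) {h n} * indicator (?H n) \<omega>" .
  qed
  also have "\<dots> = emeasure (urn_kernel a b s n h) {h n} * emeasure (?C n) (?H n)"
    using H[of n] by (simp add: nn_integral_cmult_indicator sets_Cn del: urn.C.simps)
  finally show ?thesis
    by (simp add: C mult.commute del: urn.C.simps)
qed

lemma urn_law_start: "measure (urn_law a b s) {\<omega>. \<omega> 0 = s} = 1"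
proof -
  interpret prob_space "urn_law a b s" by (rule prob_space_urn_law)
  show ?thesis
    using emeasure_urn_law_Suc[of a b s 0 "\<lambda>_. s"] emeasure_space_1
    by (simp add: urn_kernel_def measure_def)
qed

lemma urn_law_Markov:
  "measure (urn_law a b s) {\<omega>. \<forall>i\<le>Suc n. \<omega> i = h i} =
   measure (urn_law a b s) {\<omega>. \<forall>i\<le>n. \<omega> i = h i} * pmf (urn_step a b (h n)) (h (Suc n))"
  using emeasure_urn_law_Suc[of a b s "Suc n" h]
  by (simp add: measure_def urn_kernel_def emeasure_pmf_single enn2real_mult less_Suc_eq_le)

text \<open>The ratio \<open>L\<^sub>n\<close> along a trajectory, and the event that it stays within \<open>\<epsilon>\<close> of 1.\<close>

definition urn_L :: "real \<Rightarrow> real \<Rightarrow> real \<Rightarrow> real \<Rightarrow> nat \<Rightarrow> (nat \<Rightarrow> real \<times> real) \<Rightarrow> real" where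
  "urn_L a b X0 M n \<omega> =
     snd (\<omega> n) / ((M - a * real n) - X0 * (1 - a * real n / M) powr (b / a))"

definition urn_L_event :: "real \<Rightarrow> real \<Rightarrow> real \<Rightarrow> real \<Rightarrow> real \<Rightarrow> (nat \<Rightarrow> real \<times> real) set" where
  "urn_L_event a b X0 M \<epsilon> =
     {\<omega>. \<forall>n. real n < M / a \<longrightarrow> \<bar>urn_L a b X0 M n \<omega> - 1\<bar> \<le> \<epsilon>}"

lemma urn_L_event_measurable:
  "urn_L_event a b X0 M \<epsilon> \<in> sets (urn_law a b s)"
proof -
  have "(\<lambda>\<omega>. urn_L a b X0 M n \<omega>) \<in> borel_measurable (urn_law a b s)" for n
  proof -
    have "(\<lambda>\<omega>. \<omega> n) \<in> measurable (urn_law a b s) (count_space UNIV)"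
      by measurable
    then show ?thesis
      unfolding urn_L_def
      by (rule measurable_compose[where g = "\<lambda>t. snd t / _"]) simp
  qed
  note [measurable] = this
  have "{\<omega> \<in> space (urn_law a b s). \<forall>n. real n < M / a \<longrightarrow> \<bar>urn_L a b X0 M n \<omega> - 1\<bar> \<le> \<epsilon>}
      \<in> sets (urn_law a b s)"
    by measurable
  then show ?thesis by (simp add: urn_L_event_def)
qed

end

theory Submission
  imports Defs
begin

text \<open>
  Write \<open>T\<^sub>n = M - a n\<close>, let \<open>z\<^sub>n = X\<^sub>0 \<Prod>i<n. (1 - b / T\<^sub>i)\<close> be the mean of the blue balls as long as the process
  runs, and put \<open>d\<^sub>n = T\<^sub>n - z\<^sub>n\<close>. Both \<open>X\<^sub>n / z\<^sub>n\<close> and, up to summable errors, \<open>((Y\<^sub>n - d\<^sub>n) / d\<^sub>n)\<^sup>2\<close> are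
  supermartingales: one step adds at most \<open>4 b\<^sup>2 / (T\<^sub>n d\<^sub>n\<^sub>+\<^sub>1)\<close> to the second while \<open>Y\<^sub>n \<le> 2 d\<^sub>n\<close>. Since
  \<open>d\<^sub>n \<ge> c n T\<^sub>n / M\<close>, these errors sum to \<open>O(1 / K + 1 / \<surd>M)\<close> over the times with \<open>T\<^sub>n \<ge> K\<close>, however
  small \<open>Y\<^sub>0\<close> is. A maximal inequality for the sum of the two supermartingales shows that with high
  probability \<open>Y\<^sub>n\<close> stays close to \<open>d\<^sub>n\<close> while \<open>T\<^sub>n \<ge> K\<close>, and that no blue ball is left when \<open>T\<^sub>n\<close> drops
  below \<open>K\<close>, for a large constant \<open>K\<close> and \<open>M \<rightarrow> \<infinity>\<close>; from then on the process is deterministic with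
  \<open>Y\<^sub>n = T\<^sub>n\<close>. Finally \<open>z\<^sub>n\<close> differs from \<open>X\<^sub>0 (1 - a n / M)\<^bsup>b/a\<^esup>\<close> by at most \<open>b\<^sup>2 n / M\<close>, which is
  \<open>O(d\<^sub>n / K)\<close> in the first phase.
\<close>

section \<open>A maximal inequality for the urn process\<close>

text \<open>A maximal inequality of Ville type. The process given by \<open>\<Phi>\<close>, frozen
  at the value 1 once the trajectory has left \<open>G\<close>, is a supermartingale because
  \<open>\<Phi>\<close> is at least 1 outside \<open>G\<close>; its mean at the last time dominates
  the probability of an exit.\<close>

lemma emeasure_urn_law_exists_not_le:
  fixes \<Phi> :: "nat \<Rightarrow> real \<times> real \<Rightarrow> ennreal"
  assumes super: "\<And>n s. Suc n < T \<Longrightarrow> s \<in> G n \<Longrightarrow> (\<integral>\<^sup>+s'. \<Phi> (Suc n) s' \<partial>urn_step a b s) \<le> \<Phi> n s"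
    and bad: "\<And>n s. n < T \<Longrightarrow> s \<notin> G n \<Longrightarrow> 1 \<le> \<Phi> n s"
  shows "emeasure (urn_law a b s\<^sub>0) {\<omega>. \<exists>n<T. \<omega> n \<notin> G n} \<le> \<Phi> 0 s\<^sub>0"
proof (cases T)
  case 0
  then show ?thesis by simp
next
  case (Suc N)
  let ?S = "\<lambda>n. PiM {0..<n} (\<lambda>_::nat. count_space (UNIV :: (real \<times> real) set))"
  let ?C = "\<lambda>n. urn.C a b s\<^sub>0 0 n (\<lambda>_. undefined)"
  \<comment> \<open>\<open>h n\<close> records only exits before time \<open>n\<close>. An exit at
    time \<open>n\<close> itself is covered by \<open>bad\<close>, so \<open>h N\<close> still
    dominates the indicator of the whole event when \<open>T = Suc N\<close>.\<close>
  define h where "h n \<omega> = (if \<forall>i<n. \<omega> i \<in> G i then \<Phi> n (\<omega> n) else 1)" for n and \<omega> :: "nat \<Rightarrow> real \<times> real"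
  have sets_C: "sets (?C n) = sets (?S n)" for n
    using urn.sets_C[of "\<lambda>_. undefined" 0 a b s\<^sub>0 n] by simp
  have space_C: "space (?C n) = space (?S n)" for n
    using sets_C by (rule sets_eq_imp_space_eq)
  have h_meas [measurable]: "h n \<in> borel_measurable (?S (Suc n))" for n
  proof -
    have comp: "(\<lambda>\<omega>. \<omega> i) \<in> measurable (?S (Suc n)) (count_space UNIV)" if "i < Suc n" for i
      using that by (intro measurable_component_singleton) auto
    have [measurable]: "(\<lambda>\<omega>. \<Phi> n (\<omega> n)) \<in> borel_measurable (?S (Suc n))"
      by (rule measurable_compose[OF comp]) auto
    have "Measurable.pred (?S (Suc n)) (\<lambda>\<omega>. \<omega> i \<in> G i)" if "i < Suc n" for i
      by (rule measurable_compose[OF comp[OF that]]) auto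
    then have [measurable]: "Measurable.pred (?S (Suc n)) (\<lambda>\<omega>. \<forall>i\<in>{..<n}. \<omega> i \<in> G i)"
      by (intro pred_intros_finite) auto
    show ?thesis
      unfolding h_def [abs_def] lessThan_iff[symmetric] Ball_def[symmetric] by measurable
  qed
  \<comment> \<open>Disintegration of the finite-dimensional laws: the newest coordinate is
    integrated first, against the kernel.\<close>
  have step: "(\<integral>\<^sup>+\<omega>. f \<omega> \<partial>?C (Suc n)) = (\<integral>\<^sup>+\<omega>. \<integral>\<^sup>+s. f (fun_upd \<omega> n s) \<partial>urn_kernel a b s\<^sub>0 n \<omega> \<partial>?C n)"
    if [measurable]: "f \<in> borel_measurable (?S (Suc n))" for f n
  proof -
    have "(\<integral>\<^sup>+\<omega>. f \<omega> \<partial>?C (Suc n)) = (\<integral>\<^sup>+\<omega>. \<integral>\<^sup>+\<omega>'. f \<omega>' \<partial>urn.eP a b s\<^sub>0 n \<omega> \<partial>?C n)"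
    proof -
      have "urn.eP a b s\<^sub>0 n \<in> measurable (?C n) (subprob_algebra (?S (Suc n)))"
        using urn.measurable_eP[of a b s\<^sub>0 n] measurable_cong_sets[OF sets_C refl] by blast
      then show ?thesis
        using nn_integral_bind[OF that] by simp
    qed
    also have "\<dots> = (\<integral>\<^sup>+\<omega>. \<integral>\<^sup>+s. f (fun_upd \<omega> n s) \<partial>urn_kernel a b s\<^sub>0 n \<omega> \<partial>?C n)"
    proof (rule nn_integral_cong)
      fix \<omega> assume "\<omega> \<in> space (?C n)"
      then have \<omega>: "\<omega> \<in> space (?S n)" by (simp add: space_C)
      show "(\<integral>\<^sup>+\<omega>'. f \<omega>' \<partial>urn.eP a b s\<^sub>0 n \<omega>) = (\<integral>\<^sup>+s. f (fun_upd \<omega> n s) \<partial>urn_kernel a b s\<^sub>0 n \<omega>)"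
        by (rule urn.nn_integral_eP[OF \<omega> that])
    qed
    finally show ?thesis .
  qed
  have bound: "(\<integral>\<^sup>+\<omega>. h n \<omega> \<partial>?C (Suc n)) \<le> \<Phi> 0 s\<^sub>0" if "n \<le> N" for n
    using that
  proof (induction n)
    case 0
    have "emeasure (?C 0) (space (?C 0)) = 1"
      by (rule prob_space.emeasure_space_1, rule urn.prob_space_C) simp
    then show ?case
      by (subst step[OF h_meas]) (auto simp: h_def urn_kernel_def nn_integral_return)
  next
    case (Suc n)
    have "(\<integral>\<^sup>+s. h (Suc n) (fun_upd \<omega> (Suc n) s) \<partial>urn_kernel a b s\<^sub>0 (Suc n) \<omega>) \<le> h n \<omega>" for \<omega>
    proof (cases "\<forall>i<Suc n. \<omega> i \<in> G i")
      case True
      then show ?thesis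
        using super[of n "\<omega> n"] Suc.prems \<open>T = Suc N\<close> by (simp add: h_def urn_kernel_def)
    next
      case False
      then have "1 \<le> h n \<omega>"
        using bad[of n "\<omega> n"] Suc.prems \<open>T = Suc N\<close> by (auto simp: h_def less_Suc_eq)
      moreover have "h (Suc n) (fun_upd \<omega> (Suc n) s) = 1" for s
        using False by (auto simp: h_def)
      ultimately show ?thesis
        by (simp add: urn_kernel_def measure_pmf.emeasure_space_1[simplified])
    qed
    then have "(\<integral>\<^sup>+\<omega>. h (Suc n) \<omega> \<partial>?C (Suc (Suc n))) \<le> (\<integral>\<^sup>+\<omega>. h n \<omega> \<partial>?C (Suc n))"
      by (subst step[OF h_meas]) (rule nn_integral_mono)
    with Suc show ?case by simp
  qed
  let ?A = "{\<omega> \<in> space (?S T). \<exists>n\<in>{..<T}. \<omega> n \<notin> G n}"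
  have comp: "(\<lambda>\<omega>. \<omega> i) \<in> measurable (?S T) (count_space UNIV)" if "i < T" for i
    using that by (intro measurable_component_singleton) auto
  have "Measurable.pred (?S T) (\<lambda>\<omega>. \<omega> i \<notin> G i)" if "i < T" for i
    by (rule measurable_compose[OF comp[OF that]]) auto
  then have "Measurable.pred (?S T) (\<lambda>\<omega>. \<exists>i\<in>{..<T}. \<omega> i \<notin> G i)"
    by (intro pred_intros_finite) auto
  then have A: "?A \<in> sets (?S T)" by simp
  have "{\<omega>. \<exists>n<T. \<omega> n \<notin> G n} = {\<omega>. restrict \<omega> {0..<T} \<in> ?A}"
    by (auto simp: space_PiM)
  then have "emeasure (urn_law a b s\<^sub>0) {\<omega>. \<exists>n<T. \<omega> n \<notin> G n} = emeasure (?C T) ?A"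
    by (simp only: emeasure_urn_law_emb[OF A])
  also have "\<dots> = (\<integral>\<^sup>+\<omega>. indicator ?A \<omega> \<partial>?C T)"
    using A by (simp add: sets_C)
  also have "\<dots> \<le> (\<integral>\<^sup>+\<omega>. h N \<omega> \<partial>?C T)"
  proof (rule nn_integral_mono)
    show "indicator ?A \<omega> \<le> h N \<omega>" for \<omega>
      using bad[of N "\<omega> N"] \<open>T = Suc N\<close> by (auto simp: h_def less_Suc_eq split: split_indicator)
  qed
  also have "\<dots> \<le> \<Phi> 0 s\<^sub>0"
    using bound[of N] \<open>T = Suc N\<close> by simp
  finally show ?thesis .
qed

lemma sets_urn_law_exists_not:
  "{\<omega>. \<exists>n<T. \<omega> n \<notin> G n} \<in> sets (urn_law a b s)"
proof -
  have "Measurable.pred (urn_law a b s) (\<lambda>\<omega>. \<omega> n \<notin> G n)" for n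
  proof -
    have "(\<lambda>\<omega>. \<omega> n) \<in> measurable (urn_law a b s) (count_space UNIV)"
      by measurable
    then show ?thesis
      by (rule measurable_compose[where g = "\<lambda>t. t \<notin> G n"]) simp
  qed
  note [measurable] = this
  have "{\<omega> \<in> space (urn_law a b s). \<exists>n<T. \<omega> n \<notin> G n} \<in> sets (urn_law a b s)"
    by measurable
  then show ?thesis by simp
qed

lemma nn_integral_urn_step:
  assumes "0 \<le> x" "0 \<le> y" "0 < x + y" and "\<And>s. 0 \<le> f s"
  shows "(\<integral>\<^sup>+s. ennreal (f s) \<partial>urn_step a b (x, y)) =
    ennreal (x / (x + y) * f (x - b, y + b - a) + y / (x + y) * f (x, y - a))"
proof -
  have "\<not> urn_stopped (x, y)" and "1 - x / (x + y) = y / (x + y)"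
    using assms by (auto simp: urn_stopped_def field_simps)
  then show ?thesis
    using assms by (simp add: urn_step_def mult.commute flip: ennreal_mult' ennreal_plus)
qed

section \<open>The mean path\<close>

lemma one_minus_powr_ge:
  fixes u p :: real
  assumes "0 \<le> u" "u < 1" "1 \<le> p"
  shows "1 - p * u \<le> (1 - u) powr p"
proof -
  \<comment> \<open>Weighted arithmetic-geometric mean inequality for \<open>(1 - u) powr p\<close>
    and 1, with weights \<open>1 / p\<close> and \<open>1 - 1 / p\<close>.\<close>
  have "((1 - u) powr p) powr (1 / p) * 1 powr (1 - 1 / p) \<le> 1 / p * (1 - u) powr p + (1 - 1 / p) * 1"
    using assms by (intro Youngs_inequality_0) auto
  then have "1 - u \<le> 1 / p * (1 - u) powr p + (1 - 1 / p)"
    using assms by (simp add: powr_powr)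
  then have "p * (1 - u) \<le> p * (1 / p * (1 - u) powr p + (1 - 1 / p))"
    using assms by (intro mult_left_mono) auto
  also have "\<dots> = (1 - u) powr p + p - 1"
    using assms by (simp add: algebra_simps)
  finally show ?thesis
    by (simp add: algebra_simps)
qed

text \<open>With \<open>v = p * u\<close>, the bound \<open>1 - u \<le> exp (- u)\<close> leads to
  \<open>exp (- v) \<le> 1 / (1 + v)\<close>, and \<open>(1 + v) * (1 - v + v^2) = 1 + v^3\<close>
  is at least 1.\<close>

lemma one_minus_powr_le:
  fixes u p :: real
  assumes "0 \<le> u" "u < 1" "0 \<le> p"
  shows "(1 - u) powr p \<le> 1 - p * u + (p * u)\<^sup>2"
proof -
  have "(1 - u) powr p \<le> exp (- u) powr p"
    using assms exp_ge_add_one_self[of "- u"] by (intro powr_mono2) auto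
  also have "\<dots> = exp (- (p * u))"
    by (simp add: powr_def mult.commute)
  also have "\<dots> \<le> 1 / (1 + p * u)"
    using assms exp_ge_add_one_self[of "p * u"] by (simp add: exp_minus field_simps add_pos_nonneg)
  also have "\<dots> \<le> 1 - p * u + (p * u)\<^sup>2"
  proof -
    have "1 \<le> 1 + (p * u) ^ 3" using assms by simp
    also have "\<dots> = (1 - p * u + (p * u)\<^sup>2) * (1 + p * u)"
      by (simp add: algebra_simps power2_eq_square power3_eq_cube)
    finally show ?thesis using assms by (simp add: divide_le_eq add_pos_nonneg)
  qed
  finally show ?thesis .
qed

locale urn_path =
  fixes a b X M :: real
  assumes a_pos: "0 < a" and a_less_b: "a < b" and X_pos: "0 < X" and X_less_M: "X < M"
begin

definition balls :: "nat \<Rightarrow> real" where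
  "balls n = M - a * real n"

definition mean_blue :: "nat \<Rightarrow> real" where
  "mean_blue n = X * (\<Prod>i<n. 1 - b / balls i)"

definition mean_red :: "nat \<Rightarrow> real" where
  "mean_red n = balls n - mean_blue n"

text \<open>The solution of \<open>x' = - b x / (M - a t)\<close> with \<open>x(0) = X\<close>,
  whose Euler scheme with unit steps is \<open>mean_blue\<close>. The denominator of
  \<open>urn_L\<close> is \<open>balls n - limit_blue n\<close>.\<close>

definition limit_blue :: "nat \<Rightarrow> real" where
  "limit_blue n = X * (1 - a * real n / M) powr (b / a)"

text \<open>The value for which \<open>slope * (M + (b - a) n) \<le> (b - a) M\<close> holds for all \<open>n \<le> M / a\<close>.\<close>

definition slope :: real where
  "slope = a * (b - a) / b"

lemma b_pos: "0 < b" and M_pos: "0 < M"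
  using a_pos a_less_b X_pos X_less_M by linarith+

lemma slope_pos: "0 < slope"
  using a_pos a_less_b b_pos by (simp add: slope_def)

lemma balls_Suc: "balls (Suc n) = balls n - a"
  by (simp add: balls_def algebra_simps)

lemma balls_antimono: "m \<le> n \<Longrightarrow> balls n \<le> balls m"
  using a_pos by (simp add: balls_def mult_left_mono)

lemma balls_le: "balls n \<le> M"
  using a_pos by (simp add: balls_def)

lemma mean_blue_0 [simp]: "mean_blue 0 = X"
  by (simp add: mean_blue_def)

lemma mean_blue_Suc: "mean_blue (Suc n) = mean_blue n * (1 - b / balls n)"
  by (simp add: mean_blue_def)

lemma mean_red_0 [simp]: "mean_red 0 = M - X"
  by (simp add: mean_red_def balls_def)

lemma mean_red_Suc: "balls n \<noteq> 0 \<Longrightarrow> mean_red (Suc n) = mean_red n * (1 - b / balls n) + (b - a)"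
  by (simp add: mean_red_def mean_blue_Suc balls_Suc field_simps)

lemma mean_blue_pos:
  assumes "b < balls n"
  shows "0 < mean_blue n"
proof -
  have "0 < 1 - b / balls i" if "i < n" for i
    using balls_antimono[of i n] that assms b_pos by (simp add: field_simps)
  then show ?thesis
    unfolding mean_blue_def by (intro mult_pos_pos X_pos prod_pos) auto
qed

text \<open>The left-hand side is a subsolution of the recursion \<open>mean_red_Suc\<close>, whose
  source term \<open>b - a\<close> pushes the red mean up in each step. Hence the bound does not
  depend on the initial number of red balls.\<close>

lemma mean_red_ge: "b < balls n \<Longrightarrow> slope * real n * balls n / M \<le> mean_red n"
proof (induction n)
  case 0
  then show ?case using X_less_M by simp
next
  case (Suc n)
  have t: "b < balls n"
    using Suc.prems a_pos by (simp add: balls_Suc)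
  have an: "a * real n \<le> M" 
    using t b_pos by (simp add: balls_def)
  have "slope * (M + real n * (b - a)) \<le> slope * (M + M / a * (b - a))"
    using an a_pos a_less_b slope_pos
    by (intro mult_left_mono add_left_mono mult_right_mono) (simp_all add: field_simps)
  also have "\<dots> = M * (b - a)"
    using a_pos b_pos by (simp add: slope_def field_simps)
  finally have key: "slope * (M + real n * (b - a)) \<le> M * (b - a)" .
  \<comment> \<open>After division by \<open>M\<close> the first summand is the previous bound times
    \<open>1 - b / balls n\<close>; the rest has to be covered by the source term.\<close>
  have "slope * real (Suc n) * balls (Suc n) = slope * real n * (balls n - b) + slope * (balls n - a + real n * (b - a))"
    by (simp add: balls_Suc algebra_simps)
  also have "\<dots> \<le> slope * real n * (balls n - b) + slope * (M + real n * (b - a))"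
    using balls_le[of n] a_pos slope_pos by (intro add_left_mono mult_left_mono) auto
  also have "\<dots> \<le> slope * real n * (balls n - b) + M * (b - a)"
    using key by simp
  finally have "slope * real (Suc n) * balls (Suc n) / M \<le> (slope * real n * (balls n - b) + M * (b - a)) / M"
    using M_pos by (intro divide_right_mono) auto
  also have "\<dots> = slope * real n * balls n / M * (1 - b / balls n) + (b - a)"
    using M_pos t b_pos by (simp add: field_simps)
  also have "\<dots> \<le> mean_red n * (1 - b / balls n) + (b - a)"
    using Suc.IH[OF t] t b_pos by (intro add_right_mono mult_right_mono) (auto simp: field_simps)
  also have "\<dots> = mean_red (Suc n)"
    using t b_pos by (simp add: mean_red_Suc)
  finally show ?case .
qed

lemma mean_red_pos:
  assumes "b < balls n"
  shows "0 < mean_red n"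
proof (cases "n = 0")
  case True
  then show ?thesis using X_less_M by simp
next
  case False
  then have "0 < slope * real n * balls n / M"
    using assms slope_pos b_pos M_pos by simp
  then show ?thesis
    using mean_red_ge[OF assms] by linarith
qed

section \<open>Comparison with the limit curve\<close>

lemma limit_blue_eq: "limit_blue n = X * (balls n / M) powr (b / a)"
  using M_pos by (simp add: limit_blue_def balls_def diff_divide_distrib)

text \<open>Since \<open>b / a - 1\<close> is positive, the prefactor tends to 0 with
  \<open>balls n / M\<close>: on the limit curve the blue balls die out faster than the
  total.\<close>

lemma limit_blue_le:
  assumes "0 < balls n"
  shows "limit_blue n \<le> (balls n / M) powr (b / a - 1) * balls n"
proof -
  have "limit_blue n \<le> M * (balls n / M) powr (b / a)"
    using X_less_M by (simp add: limit_blue_eq mult_right_mono)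
  also have "\<dots> = (balls n / M) powr (b / a - 1) * balls n"
    using assms M_pos by (simp add: powr_diff)
  finally show ?thesis .
qed

text \<open>This keeps the denominator of \<open>urn_L\<close> positive. A power of
  \<open>balls n / M \<le> 1\<close> can only drop when the exponent rises from 1 to
  \<open>b / a\<close>, and \<open>X < M\<close> makes the inequality strict.\<close>

lemma limit_blue_less_balls:
  assumes "0 < balls n"
  shows "limit_blue n < balls n"
proof -
  have "limit_blue n < M * (balls n / M) powr (b / a)"
    using X_less_M assms M_pos by (simp add: limit_blue_eq)
  also have "(balls n / M) powr (b / a) \<le> (balls n / M) powr 1"
    using assms balls_le[of n] M_pos a_pos a_less_b by (intro powr_mono') auto
  finally show ?thesis
    using assms M_pos by simp
qed

lemma limit_blue_Suc:
  assumes "b < balls n"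
  shows "limit_blue (Suc n) = limit_blue n * (1 - a / balls n) powr (b / a)"
proof -
  have "balls (Suc n) / M = balls n / M * (1 - a / balls n)"
    using assms b_pos M_pos by (simp add: balls_Suc field_simps)
  moreover have "0 \<le> 1 - a / balls n"
    using assms a_pos a_less_b by (simp add: field_simps)
  ultimately have "(balls (Suc n) / M) powr (b / a) = (balls n / M) powr (b / a) * (1 - a / balls n) powr (b / a)"
    using assms b_pos M_pos by (simp only: powr_mult)
  then show ?thesis
    by (simp add: limit_blue_eq)
qed

text \<open>Put \<open>T = balls n\<close>. The step factor of \<open>limit_blue\<close> exceeds
  that of \<open>mean_blue\<close> by at most \<open>(b / T)^2\<close>, which costs at most
  \<open>b^2 / T\<close> because \<open>limit_blue n < T\<close>. This may be more than
  \<open>b^2 / M\<close>, but the surplus is paid for by the contraction \<open>1 - b / T\<close> of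
  the earlier error.\<close>

lemma limit_blue_error:
  "b < balls n \<Longrightarrow> mean_blue n \<le> limit_blue n \<and> limit_blue n - mean_blue n \<le> b\<^sup>2 * real n / M"
proof (induction n)
  case 0
  then show ?case using M_pos by (simp add: limit_blue_def)
next
  case (Suc n)
  have t: "b < balls n"
    using Suc.prems a_pos by (simp add: balls_Suc)
  note IH = Suc.IH[OF t]
  define r where "r = (1 - a / balls n) powr (b / a)"
  have p: "0 \<le> 1 - b / balls n" using t b_pos by (simp add: field_simps)
  have u: "0 \<le> a / balls n" "a / balls n < 1" "b / a * (a / balls n) = b / balls n"
    using t a_pos a_less_b by (auto simp: field_simps)
  have r: "1 - b / balls n \<le> r" "r \<le> 1 - b / balls n + (b / balls n)\<^sup>2"
    using one_minus_powr_ge[of "a / balls n" "b / a"] one_minus_powr_le[of "a / balls n" "b / a"] u a_pos a_less_b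
    by (auto simp: r_def)
  have nonneg: "0 \<le> limit_blue n" 
    using X_pos by (simp add: limit_blue_def)
  have "mean_blue (Suc n) \<le> limit_blue n * (1 - b / balls n)"
    using IH p by (simp add: mean_blue_Suc mult_right_mono)
  also have "\<dots> \<le> limit_blue n * r"
    using r nonneg by (intro mult_left_mono) auto
  finally have 1: "mean_blue (Suc n) \<le> limit_blue (Suc n)"
    by (simp add: limit_blue_Suc[OF t] r_def)
  have "limit_blue (Suc n) - mean_blue (Suc n) \<le> limit_blue n * (1 - b / balls n + (b / balls n)\<^sup>2) - mean_blue n * (1 - b / balls n)"
    using r nonneg by (simp add: limit_blue_Suc[OF t] mean_blue_Suc r_def[symmetric] mult_left_mono)
  also have "\<dots> = (limit_blue n - mean_blue n) * (1 - b / balls n) + limit_blue n * (b / balls n)\<^sup>2"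
    by (simp add: algebra_simps)
  also have "\<dots> \<le> b\<^sup>2 * real n / M * (1 - b / balls n) + balls n * (b / balls n)\<^sup>2"
    using IH p limit_blue_less_balls[of n] t b_pos by (intro add_mono mult_right_mono) auto
  also have "\<dots> \<le> b\<^sup>2 * real (Suc n) / M"
  proof -
    have "b\<^sup>2 * real (Suc n) / M - (b\<^sup>2 * real n / M * (1 - b / balls n) + balls n * (b / balls n)\<^sup>2)
      = b\<^sup>2 * (balls n + b * real n - M) / (M * balls n)"
      using M_pos t b_pos by (simp add: field_simps power2_eq_square)
    also have "\<dots> = b\<^sup>2 * ((b - a) * real n) / (M * balls n)"
      by (simp add: balls_def algebra_simps)
    also have "\<dots> \<ge> 0"
      using M_pos t b_pos a_less_b by simp
    finally show ?thesis by simp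
  qed
  finally show ?case using 1 by simp
qed

text \<open>By \<open>mean_red_ge\<close> the newest summand is at most
  \<open>M / (T m (T - a)) / slope\<close> with \<open>T = balls n\<close> and
  \<open>m = n + 1\<close>. Splitting \<open>M = (T - a) + a m\<close> separates the telescoping
  part \<open>1 / (T - a) - 1 / T\<close> from \<open>1 / (T m)\<close>, which is at most
  \<open>(1 / m + a / T) / M\<close>.\<close>

lemma sum_inverse_mean_red_le:
  "b < balls n \<Longrightarrow> (\<Sum>i<n. 1 / (balls i * mean_red (Suc i))) \<le>
     (2 * sqrt n / M + a * n / (M * balls n) + 1 / balls n) / slope"
proof (induction n)
  case 0
  then show ?case using b_pos slope_pos by simp
next
  case (Suc n)
  have t: "b < balls n" "b < balls n - a" "0 < balls n" "0 < balls n - a"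
    using Suc.prems a_pos b_pos by (auto simp: balls_Suc)
  \<comment> \<open>The shift by one comes from \<open>mean_red (Suc n)\<close> in the summand; it
    also keeps \<open>1 / m\<close> meaningful for \<open>n = 0\<close>.\<close>
  define m where "m = real (Suc n)"
  have m: "0 < m" "real n = m - 1" by (auto simp: m_def)
  define T where "T = balls n"
  have T: "b < T" "b < T - a" "0 < T" "0 < T - a" "balls n = T" "balls (Suc n) = T - a"
    using t by (auto simp: T_def balls_Suc)
  have M: "M = T - a + a * m"
    by (simp add: T_def balls_def m_def algebra_simps)
  have "1 / (T * mean_red (Suc n)) \<le> 1 / (T * (slope * m * (T - a) / M))"
    using mean_red_ge[OF Suc.prems, folded m_def] mean_red_pos[OF Suc.prems] T slope_pos m(1) M_pos
    by (intro divide_left_mono mult_left_mono mult_pos_pos) auto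
  also have "\<dots> = M / (T * m * (T - a)) / slope"
    by (simp add: mult_ac)
  also have "\<dots> \<le> (1 / M * (2 * sqrt m - 2 * sqrt (real n) + a / T) + (1 / (T - a) - 1 / T)) / slope"
  proof (rule divide_right_mono)
    have "M / (T * m * (T - a)) = (T - a) / (T * m * (T - a)) + a * m / (T * m * (T - a))"
      unfolding M by (rule add_divide_distrib)
    also have "(T - a) / (T * m * (T - a)) = 1 / (T * m)"
      using T by simp
    also have "a * m / (T * m * (T - a)) = 1 / (T - a) - 1 / T"
      using T m by (simp add: divide_simps)
    also have "1 / (T * m) \<le> 1 / M * (1 / m + a / T)"
    proof -
      have "1 / (T * m) = M / (M * m * T)"
        using M_pos by (simp add: mult.commute)
      also have "\<dots> \<le> (T + a * m) / (M * m * T)"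
        using M_pos m T a_pos M by (intro divide_right_mono) auto
      also have "\<dots> = 1 / M * (1 / m + a / T)"
        using T m M_pos by (simp add: divide_simps)
      finally show ?thesis .
    qed
    \<comment> \<open>The harmonic sum is bounded crudely by a telescoping square root:
      \<open>sqrt n / M\<close> still vanishes as \<open>M\<close> grows, uniformly in
      \<open>n \<le> M / a\<close>.\<close>
    also have "1 / m \<le> 2 * sqrt m - 2 * sqrt (real n)"
    proof -
      have "1 \<le> m" by (simp add: m_def)
      have "1 = (sqrt m - sqrt (real n)) * (sqrt m + sqrt (real n))"
        using m by (simp add: algebra_simps)
      also have "\<dots> \<le> (sqrt m - sqrt (real n)) * (2 * m)"
      proof (rule mult_left_mono)
        have "sqrt (real n) \<le> sqrt m" using m by simp
        moreover have "sqrt m \<le> m"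
          using \<open>1 \<le> m\<close> by (intro real_le_lsqrt) (auto simp: power2_eq_square)
        ultimately show "sqrt m + sqrt (real n) \<le> 2 * m" by linarith
      qed (use m in simp)
      finally have "1 \<le> (2 * sqrt m - 2 * sqrt (real n)) * m"
        by (simp add: algebra_simps)
      then show ?thesis using m by (simp add: pos_divide_le_eq)
    qed
    finally show "M / (T * m * (T - a)) \<le> 1 / M * (2 * sqrt m - 2 * sqrt (real n) + a / T) + (1 / (T - a) - 1 / T)"
      using M_pos by (simp add: divide_right_mono)
  qed (use slope_pos in simp)
  finally have "1 / (balls n * mean_red (Suc n)) \<le>
    (1 / M * (2 * sqrt m - 2 * sqrt (real n) + a / T) + (1 / (T - a) - 1 / T)) / slope"
    by (simp add: T)
  then have "(\<Sum>i<Suc n. 1 / (balls i * mean_red (Suc i))) \<le>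
    (2 * sqrt n / M + a * n / (M * T) + 1 / T) / slope +
    (1 / M * (2 * sqrt m - 2 * sqrt (real n) + a / T) + (1 / (T - a) - 1 / T)) / slope"
    using Suc.IH[OF t(1)] by (simp add: T)
  also have "\<dots> = (2 * sqrt m / M + a * m / (M * T) + 1 / (T - a)) / slope"
    unfolding add_divide_distrib[symmetric] m(2)
    by (simp add: algebra_simps add_divide_distrib diff_divide_distrib)
  \<comment> \<open>The accumulated terms \<open>a / (M T)\<close>, of which there are
    \<open>m\<close>, are all charged at the newest and smallest total \<open>T - a\<close>.\<close>
  also have "\<dots> \<le> (2 * sqrt m / M + a * m / (M * (T - a)) + 1 / (T - a)) / slope"
    using m M_pos T slope_pos a_pos
    by (intro divide_right_mono add_mono order_refl divide_left_mono mult_left_mono) auto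
  finally show ?case by (simp add: m_def T)
qed

text \<open>The gap \<open>e\<close> between mean and limit curve is at most
  \<open>b^2 n / M\<close>, and \<open>mean_red n\<close> is at least
  \<open>slope * n * balls n / M\<close>. The common factor \<open>n / M\<close> cancels, so a large
  \<open>balls n\<close> makes \<open>e\<close> small relative to the denominator \<open>D\<close>,
  uniformly in \<open>n\<close>.\<close>

lemma abs_ratio_le_of_near_mean:
  assumes t: "b < balls n" and \<delta>: "0 < \<delta>" "\<delta> \<le> 1"
    and large: "b\<^sup>2 * (1 + 1 / \<delta>) \<le> slope * balls n"
    and y: "\<bar>y - mean_red n\<bar> \<le> \<delta> * mean_red n"
  shows "\<bar>y / (balls n - limit_blue n) - 1\<bar> \<le> 3 * \<delta>"
proof -
  define e where "e = limit_blue n - mean_blue n"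
  define D where "D = balls n - limit_blue n"
  have d: "mean_red n = D + e"
    by (simp add: D_def e_def mean_red_def)
  have e: "0 \<le> e" "e \<le> b\<^sup>2 * real n / M"
    using limit_blue_error[OF t] by (auto simp: e_def)
  have D: "0 < D"
    using limit_blue_less_balls[of n] t b_pos by (simp add: D_def)
  have "b\<^sup>2 * (1 + 1 / \<delta>) * (real n / M) \<le> slope * balls n * (real n / M)"
    using large M_pos by (intro mult_right_mono) auto
  also have "\<dots> \<le> D + e"
    using mean_red_ge[OF t] d by (simp add: mult_ac)
  finally have "(1 + 1 / \<delta>) * (b\<^sup>2 * real n / M) \<le> D + e"
    by (simp add: mult_ac)
  moreover have "(1 + 1 / \<delta>) * e \<le> (1 + 1 / \<delta>) * (b\<^sup>2 * real n / M)"
    using e \<delta> by (intro mult_left_mono) auto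
  ultimately have "(1 + 1 / \<delta>) * e \<le> D + e"
    by linarith
  \<comment> \<open>The constant \<open>1 + 1 / \<delta>\<close> in \<open>large\<close> is chosen
    so that one \<open>e\<close> cancels here.\<close>
  then have e_le: "e \<le> \<delta> * D"
    using \<delta> by (simp add: field_simps)
  have "(1 + \<delta>) * (D + e) \<le> (1 + \<delta>) * (D + \<delta> * D)"
    using e_le \<delta> by (intro mult_left_mono) auto
  also have "\<dots> = (1 + 2 * \<delta> + \<delta> * \<delta>) * D"
    by (simp add: algebra_simps)
  \<comment> \<open>The factor 3 in the conclusion comes from
    \<open>(1 + \<delta>)^2 \<le> 1 + 3 * \<delta>\<close>, valid for
    \<open>\<delta> \<le> 1\<close>.\<close>
  also have "\<dots> \<le> (1 + 3 * \<delta>) * D"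
    using \<delta> D mult_left_mono[of \<delta> 1 \<delta>] by (intro mult_right_mono) auto
  finally have upper: "y \<le> (1 + 3 * \<delta>) * D"
    using y d by (simp add: algebra_simps)
  have "(1 - 3 * \<delta>) * D \<le> (1 - \<delta>) * D"
    using \<delta> D by (intro mult_right_mono) auto
  also have "\<dots> \<le> (1 - \<delta>) * (D + e)"
    using \<delta> e by (intro mult_left_mono) auto
  also have "\<dots> \<le> y"
    using y d by (simp add: algebra_simps)
  finally have "(1 - 3 * \<delta>) * D \<le> y" .
  with upper show ?thesis
    unfolding D_def[symmetric] using D by (simp add: abs_le_iff field_simps)
qed

text \<open>Without blue balls the red count is \<open>T = balls n\<close>, and the ratio exceeds 1
  by \<open>l / (T - l)\<close> with \<open>l = limit_blue n\<close>. This is at most \<epsilon>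
  exactly when \<open>l \<le> \<epsilon> / (1 + \<epsilon>) * T\<close>.\<close>

lemma abs_ratio_le_of_no_blue:
  assumes t: "0 < balls n" and \<epsilon>: "0 < \<epsilon>"
    and small: "(balls n / M) powr (b / a - 1) \<le> \<epsilon> / (1 + \<epsilon>)"
  shows "\<bar>balls n / (balls n - limit_blue n) - 1\<bar> \<le> \<epsilon>"
proof -
  have "limit_blue n \<le> \<epsilon> / (1 + \<epsilon>) * balls n"
    using limit_blue_le[OF t] mult_right_mono[OF small, of "balls n"] t by linarith
  then have "limit_blue n * (1 + \<epsilon>) \<le> \<epsilon> * balls n"
    using \<epsilon> by (simp add: field_simps)
  moreover have "0 \<le> limit_blue n"
    using X_pos by (simp add: limit_blue_def)
  ultimately show ?thesis
    using limit_blue_less_balls[OF t] \<epsilon> by (simp add: abs_le_iff field_simps)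
qed

section \<open>Concentration around the mean path\<close>

text \<open>The last term is at least 1 at time \<open>N\<close> as soon as \<open>x \<ge> b\<close>, that is, if a blue ball is left.\<close>

definition potential :: "real \<Rightarrow> nat \<Rightarrow> nat \<Rightarrow> real \<times> real \<Rightarrow> real" where
  "potential \<epsilon> N n = (\<lambda>(x, y). (y - mean_red n)\<^sup>2 / (\<epsilon> * mean_red n)\<^sup>2 +
     (\<Sum>i=n..<N. 4 * b\<^sup>2 / (\<epsilon>\<^sup>2 * (balls i * mean_red (Suc i)))) +
     x / mean_blue n * (mean_blue N / b))"

lemma potential_nonneg:
  assumes "b < balls N" "n \<le> N" "0 \<le> x"
  shows "0 \<le> potential \<epsilon> N n (x, y)"
proof -
  have "b < balls i" if "i \<le> N" for i
    using balls_antimono[OF that] assms by linarith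
  then have "0 < balls i * mean_red (Suc i)" if "i < N" for i
    using that b_pos by (intro mult_pos_pos mean_red_pos) (auto intro: less_trans)
  then have "0 \<le> (\<Sum>i=n..<N. 4 * b\<^sup>2 / (\<epsilon>\<^sup>2 * (balls i * mean_red (Suc i))))"
    by (intro sum_nonneg divide_nonneg_nonneg mult_nonneg_nonneg[OF zero_le_power2]) (auto intro: less_imp_le)
  moreover have "0 < mean_blue n" "0 < mean_blue N"
    using \<open>\<And>i. i \<le> N \<Longrightarrow> b < balls i\<close> assms by (auto intro: mean_blue_pos)
  ultimately show ?thesis
    using assms b_pos by (simp add: potential_def)
qed

text \<open>The relative squared deviation of the red count contracts up to a Bernoulli variance,
  the summand \<open>W n\<close> that leaves the sum pays for this variance, and the blue term is an
  exact martingale.\<close>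

lemma potential_step:
  assumes t: "2 * b \<le> balls N" and n: "n < N" and \<epsilon>: "0 < \<epsilon>"
    and xy: "x + y = balls n" "0 \<le> x" "0 \<le> y" "y \<le> 2 * mean_red n"
  shows "x / (x + y) * potential \<epsilon> N (Suc n) (x - b, y + b - a) + y / (x + y) * potential \<epsilon> N (Suc n) (x, y - a)
    \<le> potential \<epsilon> N n (x, y)"
proof -
  define T d d' q U where "T = balls n" and "d = mean_red n" and "d' = mean_red (Suc n)"
    and "q = 1 - b / T" and "U = y - d"
  have "balls N \<le> balls (Suc n)" "balls N \<le> T"
    using n by (auto simp: T_def intro!: balls_antimono)
  then have T: "2 * b \<le> T" "0 < T" "b < balls n" "b < balls (Suc n)"
    using t b_pos by (auto simp: T_def)
  have q: "1 / 2 \<le> q"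
    using T by (simp add: q_def field_simps)
  have d: "0 < d" "0 < d'" and d': "d' = d * q + (b - a)"
    using T by (auto simp: d_def d'_def q_def T_def intro!: mean_red_pos) (simp add: mean_red_Suc)
  \<comment> \<open>\<open>dq\<close> makes the relative deviation contract; \<open>d_le\<close> and
    \<open>y \<le> 2 * mean_red n\<close> supply the two factors 2 of the constant 4 in
    \<open>W\<close>.\<close>
  have dq: "d * q \<le> d'" and d_le: "d \<le> 2 * d'"
    using d' a_less_b mult_left_mono[OF q, of d] d by linarith+
  have p: "x / (x + y) = 1 - y / T" "y / (x + y) = y / T"
    using xy T by (auto simp: T_def[symmetric] field_simps)
  have x: "x = T - y" using xy by (simp add: T_def)
  define W where "W i = 4 * b\<^sup>2 / (\<epsilon>\<^sup>2 * (balls i * mean_red (Suc i)))" for i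
  have W: "(\<Sum>i=n..<N. W i) = W n + (\<Sum>i=Suc n..<N. W i)"
    using n by (simp add: sum.atLeast_Suc_lessThan)
  \<comment> \<open>Second moment as squared mean plus variance: the new deviation has mean
    \<open>q * U\<close> and is, up to a shift, \<open>b\<close> times a Bernoulli variable.\<close>
  have "(1 - y / T) * (y + b - a - d')\<^sup>2 + y / T * (y - a - d')\<^sup>2 = (q * U)\<^sup>2 + b\<^sup>2 * (y / T * (1 - y / T))"
  proof -
    have *: "y + b - a - d' = U + b * (d / T)" "y - a - d' = U + b * (d / T) - b"
      "q * U = U + b * (d / T) - b * (y / T)"
      using T by (auto simp: d' q_def U_def algebra_simps diff_divide_distrib)
    have "(1 - r) * (U + b * e)\<^sup>2 + r * (U + b * e - b)\<^sup>2 = (U + b * e - b * r)\<^sup>2 + b\<^sup>2 * (r * (1 - r))" for r e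
      by (simp add: algebra_simps power2_eq_square)
    then show ?thesis
      unfolding * .
  qed
  also have "\<dots> \<le> (q * U)\<^sup>2 + b\<^sup>2 * (2 * d / T)"
  proof -
    have "y / T * (1 - y / T) \<le> 2 * d / T * 1"
      using xy T d x by (intro mult_mono divide_right_mono) (auto simp: d_def)
    then have "y / T * (1 - y / T) \<le> 2 * d / T"
      by simp
    then show ?thesis
      by (intro add_left_mono mult_left_mono) auto
  qed
  finally have "((1 - y / T) * (y + b - a - d')\<^sup>2 + y / T * (y - a - d')\<^sup>2) / (\<epsilon> * d')\<^sup>2
     \<le> ((q * U)\<^sup>2 + b\<^sup>2 * (2 * d / T)) / (\<epsilon> * d')\<^sup>2"
    by (intro divide_right_mono) auto
  also have "\<dots> = (q * U)\<^sup>2 / (\<epsilon> * d')\<^sup>2 + b\<^sup>2 * (2 * d / T) / (\<epsilon> * d')\<^sup>2"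
    by (rule add_divide_distrib)
  also have "\<dots> \<le> U\<^sup>2 / (\<epsilon> * d)\<^sup>2 + W n"
  proof (rule add_mono)
    have "(q * U)\<^sup>2 / (\<epsilon> * d')\<^sup>2 \<le> (q * U)\<^sup>2 / (\<epsilon> * (d * q))\<^sup>2"
      using dq \<epsilon> d q by (intro divide_left_mono power_mono mult_left_mono mult_pos_pos) auto
    also have "\<dots> = U\<^sup>2 / (\<epsilon> * d)\<^sup>2"
      using q by (simp add: power_mult_distrib)
    finally show "(q * U)\<^sup>2 / (\<epsilon> * d')\<^sup>2 \<le> U\<^sup>2 / (\<epsilon> * d)\<^sup>2" .
    have "b\<^sup>2 * (2 * d / T) / (\<epsilon> * d')\<^sup>2 \<le> b\<^sup>2 * (2 * (2 * d') / T) / (\<epsilon> * d')\<^sup>2"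
      using d_le T by (intro divide_right_mono mult_left_mono) auto
    also have "\<dots> = W n"
      using d by (simp add: W_def T_def[symmetric] d'_def[symmetric] power2_eq_square mult_ac)
    finally show "b\<^sup>2 * (2 * d / T) / (\<epsilon> * d')\<^sup>2 \<le> W n" .
  qed
  finally have quadratic: "(1 - y / T) * ((y + b - a - d')\<^sup>2 / (\<epsilon> * d')\<^sup>2) + y / T * ((y - a - d')\<^sup>2 / (\<epsilon> * d')\<^sup>2)
      \<le> U\<^sup>2 / (\<epsilon> * d)\<^sup>2 + W n"
    by (simp add: add_divide_distrib)
  have "(1 - y / T) * (x - b) + y / T * x = x * q"
    using T by (simp add: x q_def field_simps)
  moreover have "(1 - y / T) * ((x - b) / m) + y / T * (x / m) = ((1 - y / T) * (x - b) + y / T * x) / m" for m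
    by (simp only: add_divide_distrib times_divide_eq_right)
  ultimately have "(1 - y / T) * ((x - b) / (mean_blue n * q)) + y / T * (x / (mean_blue n * q)) =
      x * q / (mean_blue n * q)"
    by simp
  also have "\<dots> = x / mean_blue n"
    using q by simp
  finally have linear: "(1 - y / T) * ((x - b) / mean_blue (Suc n)) + y / T * (x / mean_blue (Suc n)) = x / mean_blue n"
    by (simp add: mean_blue_Suc q_def T_def)
  have "x / (x + y) * potential \<epsilon> N (Suc n) (x - b, y + b - a) + y / (x + y) * potential \<epsilon> N (Suc n) (x, y - a)
    = ((1 - y / T) * ((y + b - a - d')\<^sup>2 / (\<epsilon> * d')\<^sup>2) + y / T * ((y - a - d')\<^sup>2 / (\<epsilon> * d')\<^sup>2))
      + (\<Sum>i=Suc n..<N. W i)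
      + ((1 - y / T) * ((x - b) / mean_blue (Suc n)) + y / T * (x / mean_blue (Suc n))) * (mean_blue N / b)"
    unfolding potential_def p prod.case d'_def[symmetric] W_def[symmetric]
    by (simp only: algebra_simps)
  also have "\<dots> \<le> U\<^sup>2 / (\<epsilon> * d)\<^sup>2 + W n + (\<Sum>i=Suc n..<N. W i) + x / mean_blue n * (mean_blue N / b)"
    unfolding linear using quadratic by simp
  also have "\<dots> = potential \<epsilon> N n (x, y)"
    by (simp add: potential_def W_def[symmetric] W U_def d_def)
  finally show ?thesis .
qed

text \<open>Restricting blue counts to multiples of \<open>b\<close> makes every nonzero count at
  least \<open>b\<close>, so a blue draw never leads below 0. Extinction of blue at time
  \<open>N\<close> makes the later course deterministic, hence the single state there.\<close>

definition typical :: "real \<Rightarrow> nat \<Rightarrow> nat \<Rightarrow> (real \<times> real) set" where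
  "typical \<epsilon> N n = (if n \<le> N
     then {(x, y). x \<in> range (\<lambda>k. real k * b) \<and> x + y = balls n \<and>
       \<bar>y - mean_red n\<bar> \<le> \<epsilon> * mean_red n \<and> (n = N \<longrightarrow> x = 0)}
     else {(0, balls n)})"

text \<open>The maximal inequality is applied to the potential up to time \<open>N\<close> and
  afterwards to the indicator of having left the only possible trajectory.\<close>

lemma emeasure_not_typical_le:
  assumes t: "2 * b \<le> balls N" and \<epsilon>: "0 < \<epsilon>" "\<epsilon> \<le> 1" and X: "X = real k * b"
    and T: "\<And>n. n < T \<Longrightarrow> 0 < balls n"
  shows "emeasure (urn_law a b (X, M - X)) {\<omega>. \<exists>n<T. \<omega> n \<notin> typical \<epsilon> N n}
    \<le> ennreal (potential \<epsilon> N 0 (X, M - X))"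
proof -
  define R where "R n = {(x, y). x \<in> range (\<lambda>k. real k * b) \<and> x + y = balls n}" for n
  define \<Phi> where "\<Phi> n s = (if n \<le> N then if s \<in> R n then potential \<epsilon> N n s else 1
    else if s = (0, balls n) then 0 else 1)" for n and s :: "real \<times> real"
  have large: "b < balls n" if "n \<le> N" for n
    using balls_antimono[OF that] t b_pos by linarith
  have \<Phi>_nonneg: "0 \<le> \<Phi> n s" for n s
    using potential_nonneg[of N n] large b_pos by (auto simp: \<Phi>_def R_def)
  have "emeasure (urn_law a b (X, M - X)) {\<omega>. \<exists>n<T. \<omega> n \<notin> typical \<epsilon> N n} \<le> ennreal (\<Phi> 0 (X, M - X))"
  proof (rule emeasure_urn_law_exists_not_le)
    fix n and s :: "real \<times> real"
    obtain x y where s: "s = (x, y)" by fastforce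
    assume n: "Suc n < T" and typ_s: "s \<in> typical \<epsilon> N n"
    have tn: "0 < balls n" using T[of n] n by simp
    show "(\<integral>\<^sup>+ s'. ennreal (\<Phi> (Suc n) s') \<partial>urn_step a b s) \<le> ennreal (\<Phi> n s)"
    proof (cases "n < N")
      case True
      from typ_s True obtain j where j: "x = real j * b" and xy: "x + y = balls n"
        and y: "\<bar>y - mean_red n\<bar> \<le> \<epsilon> * mean_red n"
        by (auto simp: typical_def s)
      have "0 < mean_red n" using True by (intro mean_red_pos large) simp
      then have "\<epsilon> * mean_red n \<le> 1 * mean_red n" using \<epsilon> by (intro mult_right_mono) auto
      then have y: "0 \<le> y" "y \<le> 2 * mean_red n" using y by auto
      have x: "0 \<le> x" using j b_pos by simp
      have blue: "x / (x + y) * \<Phi> (Suc n) (x - b, y + b - a) = x / (x + y) * potential \<epsilon> N (Suc n) (x - b, y + b - a)"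
      \<comment> \<open>With no blue ball the successor has blue count \<open>- b\<close> and lies
        outside \<open>R\<close>, but its probability is 0.\<close>
      proof (cases j)
        case 0
        then show ?thesis by (simp add: j)
      next
        case (Suc i)
        then have "(x - b, y + b - a) \<in> R (Suc n)"
          using xy by (auto simp: R_def j balls_Suc algebra_simps)
        then show ?thesis using True by (simp add: \<Phi>_def)
      qed
      have red: "\<Phi> (Suc n) (x, y - a) = potential \<epsilon> N (Suc n) (x, y - a)"
        using True xy by (auto simp: \<Phi>_def R_def j balls_Suc)
      have "(\<integral>\<^sup>+ s'. ennreal (\<Phi> (Suc n) s') \<partial>urn_step a b s)
         = ennreal (x / (x + y) * \<Phi> (Suc n) (x - b, y + b - a) + y / (x + y) * \<Phi> (Suc n) (x, y - a))"
        unfolding s using x y xy tn \<Phi>_nonneg by (intro nn_integral_urn_step) auto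
      also have "\<dots> \<le> ennreal (potential \<epsilon> N n (x, y))"
        unfolding blue red using potential_step[OF t True \<epsilon>(1) xy x y] by (rule ennreal_leI)
      also have "potential \<epsilon> N n (x, y) = \<Phi> n s"
        using True xy by (auto simp: \<Phi>_def R_def j s)
      finally show ?thesis .
    next
      case False
      \<comment> \<open>This includes \<open>n = N\<close>, where being typical already forces
        \<open>x = 0\<close>.\<close>
      then have "s = (0, balls n)"
        using typ_s by (auto simp: typical_def s split: if_splits)
      then have "(\<integral>\<^sup>+ s'. ennreal (\<Phi> (Suc n) s') \<partial>urn_step a b s) = ennreal (\<Phi> (Suc n) (0, balls n - a))"
        using nn_integral_urn_step[of 0 "balls n" "\<Phi> (Suc n)" a b] tn \<Phi>_nonneg by simp
      also have "\<Phi> (Suc n) (0, balls n - a) = 0"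
        using False by (simp add: \<Phi>_def balls_Suc)
      finally show ?thesis by simp
    qed
  next
    fix n and s :: "real \<times> real"
    obtain x y where s: "s = (x, y)" by fastforce
    assume n: "n < T" and atyp: "s \<notin> typical \<epsilon> N n"
    have "1 \<le> \<Phi> n s"
    proof (cases "n \<le> N \<and> s \<in> R n")
      case False
      then show ?thesis using atyp by (auto simp: \<Phi>_def typical_def R_def s)
    next
      case True
      then obtain j where j: "x = real j * b" and xy: "x + y = balls n"
        by (auto simp: R_def s)
      have pos: "0 < mean_red n" "0 < mean_blue n" "0 < mean_blue N"
        using True by (auto intro!: mean_red_pos mean_blue_pos large)
      have sum: "0 \<le> (\<Sum>i=n..<N. 4 * b\<^sup>2 / (\<epsilon>\<^sup>2 * (balls i * mean_red (Suc i))))"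
        using potential_nonneg[OF large, of N n 0 \<epsilon> "mean_red n"] True by (simp add: potential_def)
      have x: "0 \<le> x" using j b_pos by simp
      have "1 \<le> potential \<epsilon> N n (x, y)"
      proof (cases "\<bar>y - mean_red n\<bar> \<le> \<epsilon> * mean_red n")
        case False
        then have "(\<epsilon> * mean_red n)\<^sup>2 \<le> (y - mean_red n)\<^sup>2"
          using pos \<epsilon> by (simp add: abs_le_square_iff[symmetric])
        then have "1 \<le> (y - mean_red n)\<^sup>2 / (\<epsilon> * mean_red n)\<^sup>2"
          using pos \<epsilon> by simp
        moreover have "0 \<le> x / mean_blue n * (mean_blue N / b)"
          using x pos b_pos by simp
        ultimately show ?thesis
          using sum by (simp add: potential_def)
      next
        case True
        \<comment> \<open>The red count is within its bounds, so only blue balls surviving at time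
          \<open>N\<close> can be atypical; the blue term then equals \<open>j\<close>.\<close>
        then have "n = N" "j \<noteq> 0"
          using atyp j xy \<open>n \<le> N \<and> s \<in> R n\<close> by (auto simp: typical_def s)
        then have "1 \<le> x / mean_blue n * (mean_blue N / b)"
          using pos b_pos by (simp add: j)
        then show ?thesis
          using sum by (simp add: potential_def add_increasing)
      qed
      then show ?thesis using True by (simp add: \<Phi>_def s)
    qed
    then show "1 \<le> ennreal (\<Phi> n s)" by simp
  qed
  moreover have "\<Phi> 0 (X, M - X) = potential \<epsilon> N 0 (X, M - X)"
    by (auto simp: \<Phi>_def R_def balls_def X)
  ultimately show ?thesis by simp
qed

section \<open>The probability bound for one starting configuration\<close>

lemma potential_0_le:
  assumes K: "2 * b \<le> K" "K \<le> balls N" "balls N < K + a" and \<epsilon>: "0 < \<epsilon>"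
  shows "potential \<epsilon> N 0 (X, M - X) \<le>
    4 * b\<^sup>2 / (\<epsilon>\<^sup>2 * slope) * (2 * sqrt (M / a) / M + 2 / K) + M * ((K + a) / M) powr (b / a) / b"
proof -
  have large: "b < balls N" "0 < balls N" "0 < K"
    using K b_pos by linarith+
  have aN: "a * real N \<le> M"
    using large by (simp add: balls_def)
  have "(\<Sum>i=0..<N. 4 * b\<^sup>2 / (\<epsilon>\<^sup>2 * (balls i * mean_red (Suc i)))) =
      4 * b\<^sup>2 / \<epsilon>\<^sup>2 * (\<Sum>i<N. 1 / (balls i * mean_red (Suc i)))"
    by (simp add: sum_distrib_left atLeast0LessThan)
  also have "\<dots> \<le> 4 * b\<^sup>2 / \<epsilon>\<^sup>2 * ((2 * sqrt (M / a) / M + 2 / K) / slope)"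
  proof (rule mult_left_mono)
    have "2 * sqrt N / M \<le> 2 * sqrt (M / a) / M"
      using aN a_pos M_pos by (intro divide_right_mono) (auto simp: field_simps)
    moreover have "a * real N / (M * balls N) \<le> M / (M * balls N)"
      using aN M_pos large by (intro divide_right_mono) auto
    moreover have "1 / balls N \<le> 1 / K"
      using K large by (simp add: divide_left_mono)
    ultimately have "2 * sqrt N / M + a * real N / (M * balls N) + 1 / balls N \<le> 2 * sqrt (M / a) / M + 2 / K"
      using M_pos by simp
    then have "(2 * sqrt N / M + a * real N / (M * balls N) + 1 / balls N) / slope \<le> (2 * sqrt (M / a) / M + 2 / K) / slope"
      using slope_pos by (intro divide_right_mono) auto
    then show "(\<Sum>i<N. 1 / (balls i * mean_red (Suc i))) \<le> (2 * sqrt (M / a) / M + 2 / K) / slope"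
      using sum_inverse_mean_red_le[OF large(1)] by linarith
  qed simp
  finally have sum: "(\<Sum>i=0..<N. 4 * b\<^sup>2 / (\<epsilon>\<^sup>2 * (balls i * mean_red (Suc i)))) \<le>
      4 * b\<^sup>2 / (\<epsilon>\<^sup>2 * slope) * (2 * sqrt (M / a) / M + 2 / K)"
    by simp
  have "mean_blue N \<le> X * (balls N / M) powr (b / a)"
    using limit_blue_error[OF large(1)] by (simp add: limit_blue_eq)
  also have "\<dots> \<le> M * ((K + a) / M) powr (b / a)"
    using K large M_pos X_less_M X_pos a_pos b_pos
    by (intro mult_mono powr_mono2 divide_right_mono) auto
  finally have "mean_blue N / b \<le> M * ((K + a) / M) powr (b / a) / b"
    using b_pos by (intro divide_right_mono) auto
  \<comment> \<open>At time 0 the quadratic term vanishes because \<open>mean_red 0 = M - X\<close>,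
    and the blue term reduces to \<open>mean_blue N / b\<close>.\<close>
  with sum show ?thesis
    using X_pos by (simp add: potential_def)
qed

text \<open>Two regimes meet at \<open>N\<close>, the last time with at least \<open>K\<close>
  balls. Up to \<open>N\<close> closeness to the mean carries over to the limit curve; after
  \<open>N\<close> only red balls remain and the total is a small fraction of
  \<open>M\<close>.\<close>

lemma abs_urn_L_le_of_typical:
  assumes \<delta>: "0 < \<delta>" "\<delta> \<le> 1" and K: "2 * b \<le> K" "K \<le> balls N" "balls N < K + a"
    and large: "b\<^sup>2 * (1 + 1 / \<delta>) \<le> slope * K"
    and small: "((K + a) / M) powr (b / a - 1) \<le> 3 * \<delta> / (1 + 3 * \<delta>)"
    and n: "0 < balls n" and typ_n: "\<omega> n \<in> typical \<delta> N n"
  shows "\<bar>urn_L a b X M n \<omega> - 1\<bar> \<le> 3 * \<delta>"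
proof -
  have L: "urn_L a b X M n \<omega> = snd (\<omega> n) / (balls n - limit_blue n)"
    by (simp add: urn_L_def balls_def limit_blue_def)
  show ?thesis
  proof (cases "n \<le> N")
    case True
    then have t: "K \<le> balls n"
      using balls_antimono[OF True] K by simp
    have "b\<^sup>2 * (1 + 1 / \<delta>) \<le> slope * balls n"
      using large t slope_pos mult_left_mono[OF t, of slope] by linarith
    moreover have "\<bar>snd (\<omega> n) - mean_red n\<bar> \<le> \<delta> * mean_red n"
      using typ_n True by (auto simp: typical_def)
    ultimately show ?thesis
      unfolding L using t K b_pos \<delta> by (intro abs_ratio_le_of_near_mean) auto
  next
    case False
    then have "balls n \<le> K + a"
      using balls_antimono[of N n] K by simp
    then have "(balls n / M) powr (b / a - 1) \<le> ((K + a) / M) powr (b / a - 1)"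
      using n M_pos a_pos a_less_b by (intro powr_mono2 divide_right_mono) auto
    then have "\<bar>balls n / (balls n - limit_blue n) - 1\<bar> \<le> 3 * \<delta>"
      using small \<delta> n by (intro abs_ratio_le_of_no_blue) auto
    then show ?thesis
      using typ_n False by (simp add: L typical_def)
  qed
qed

lemma prob_urn_L_event_ge:
  assumes \<delta>: "0 < \<delta>" "\<delta> \<le> 1" and K: "2 * b \<le> K" "K \<le> M" and X: "X = real k * b"
    and large: "b\<^sup>2 * (1 + 1 / \<delta>) \<le> slope * K"
    and small: "((K + a) / M) powr (b / a - 1) \<le> 3 * \<delta> / (1 + 3 * \<delta>)"
  shows "1 - (4 * b\<^sup>2 / (\<delta>\<^sup>2 * slope) * (2 * sqrt (M / a) / M + 2 / K) + M * ((K + a) / M) powr (b / a) / b)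
    \<le> measure (urn_law a b (X, M - X)) (urn_L_event a b X M (3 * \<delta>))"
proof -
  interpret prob_space "urn_law a b (X, M - X)" by (rule prob_space_urn_law)
  \<comment> \<open>The last time with at least \<open>K\<close> balls; \<open>T\<close> below
    counts the times \<open>n < M / a\<close>, at which the total is positive.\<close>
  define N where "N = nat \<lfloor>(M - K) / a\<rfloor>"
  define T where "T = nat \<lceil>M / a\<rceil>"
  let ?B = "{\<omega>. \<exists>n<T. \<omega> n \<notin> typical \<delta> N n}"
  have "real N \<le> (M - K) / a" "(M - K) / a < real N + 1"
    using K a_pos by (auto simp: N_def)
  then have N: "K \<le> balls N" "balls N < K + a"
    using a_pos by (auto simp: balls_def field_simps)
  have T: "n < T \<longleftrightarrow> real n < M / a" for n
    unfolding T_def by linarith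
  have pos: "real n < M / a \<longleftrightarrow> 0 < balls n" for n
    using a_pos by (simp add: balls_def field_simps)
  have B: "?B \<in> events" by (rule sets_urn_law_exists_not)
  have "emeasure (urn_law a b (X, M - X)) ?B \<le> ennreal (potential \<delta> N 0 (X, M - X))"
    using N K \<delta> X T pos by (intro emeasure_not_typical_le) auto
  moreover have "0 \<le> potential \<delta> N 0 (X, M - X)"
    using N K b_pos X_pos by (intro potential_nonneg) auto
  ultimately have "prob ?B \<le> potential \<delta> N 0 (X, M - X)"
    by (simp add: emeasure_eq_measure)
  moreover have "space (urn_law a b (X, M - X)) - ?B \<subseteq> urn_L_event a b X M (3 * \<delta>)"
    using abs_urn_L_le_of_typical[OF \<delta> K(1) N large small]
    by (auto simp: urn_L_event_def T pos)
  then have "prob (space (urn_law a b (X, M - X)) - ?B) \<le> prob (urn_L_event a b X M (3 * \<delta>))"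
    by (rule finite_measure_mono[OF _ urn_L_event_measurable])
  then have "1 - prob ?B \<le> prob (urn_L_event a b X M (3 * \<delta>))"
    unfolding prob_compl[OF B] .
  ultimately show ?thesis
    using potential_0_le[OF K(1) N \<delta>(1)] by linarith
qed

end

section \<open>Uniform limit as \<open>M\<close> tends to infinity\<close>

lemma eventually_urn_L_event_ge:
  fixes a b \<epsilon> \<eta> :: real
  assumes ab: "0 < a" "a < b" and \<epsilon>: "0 < \<epsilon>" and \<eta>: "0 < \<eta>"
  shows "\<forall>\<^sub>F M in at_top. \<forall>k::nat. 0 < real k * b \<longrightarrow> real k * b < M \<longrightarrow>
    1 - \<eta> \<le> measure (urn_law a b (real k * b, M - real k * b)) (urn_L_event a b (real k * b) M \<epsilon>)"
proof -
  define \<delta> where "\<delta> = min (\<epsilon> / 3) 1"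
  define c where "c = a * (b - a) / b"
  define C where "C = 4 * b\<^sup>2 / (\<delta>\<^sup>2 * c)"
  \<comment> \<open>\<open>K\<close> depends on \<delta> and \<eta> and is fixed before
    \<open>M\<close> grows. Its entries serve, in turn, \<open>potential_step\<close>, the passage
    from the mean to the limit curve, and \<open>C * (2 / K) \<le> \<eta> / 3\<close>.\<close>
  define K where "K = Max {2 * b, b\<^sup>2 * (1 + 1 / \<delta>) / c, 6 * C / \<eta>}"
  have \<delta>: "0 < \<delta>" "\<delta> \<le> 1" "3 * \<delta> \<le> \<epsilon>"
    using \<epsilon> by (auto simp: \<delta>_def)
  have c: "0 < c" and C: "0 < C"
    using ab \<delta> by (auto simp: c_def C_def)
  have "2 * b \<le> K" "b\<^sup>2 * (1 + 1 / \<delta>) / c \<le> K" "6 * C / \<eta> \<le> K"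
    by (auto simp: K_def)
  then have K: "2 * b \<le> K" "0 < K" "b\<^sup>2 * (1 + 1 / \<delta>) \<le> c * K" "C * (2 / K) \<le> \<eta> / 3"
    using c ab \<eta> by (auto simp: field_simps)
  have lim1: "((\<lambda>M. ((K + a) / M) powr (b / a - 1)) \<longlongrightarrow> 0) at_top"
  proof -
    have "((\<lambda>M. (K + a) powr (b / a - 1) * M powr (- (b / a - 1))) \<longlongrightarrow> (K + a) powr (b / a - 1) * 0) at_top"
      using ab by (intro tendsto_mult tendsto_const tendsto_neg_powr filterlim_ident) auto
    moreover have "\<forall>\<^sub>F M in at_top. (K + a) powr (b / a - 1) * M powr (- (b / a - 1)) = ((K + a) / M) powr (b / a - 1)"
      using eventually_gt_at_top[of 0]
      by eventually_elim (use K ab in \<open>simp add: powr_divide powr_diff\<close>)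
    ultimately show ?thesis
      by (auto intro: Lim_transform_eventually)
  qed
  have lim2: "((\<lambda>M. M * ((K + a) / M) powr (b / a) / b) \<longlongrightarrow> 0) at_top"
  proof -
    \<comment> \<open>One factor \<open>(K + a) / M\<close> of the power cancels \<open>M\<close>;
      the remaining power decays because \<open>a < b\<close>.\<close>
    have "((\<lambda>M. (K + a) / b * ((K + a) / M) powr (b / a - 1)) \<longlongrightarrow> (K + a) / b * 0) at_top"
      by (intro tendsto_mult tendsto_const lim1)
    moreover have "\<forall>\<^sub>F M in at_top. (K + a) / b * ((K + a) / M) powr (b / a - 1) = M * ((K + a) / M) powr (b / a) / b"
      using eventually_gt_at_top[of 0]
      by eventually_elim (use K ab in \<open>simp add: powr_diff\<close>)
    ultimately show ?thesis
      by (auto intro: Lim_transform_eventually)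
  qed
  have lim3: "((\<lambda>M. C * (2 * sqrt (M / a) / M)) \<longlongrightarrow> 0) at_top"
  proof -
    have "((\<lambda>M. C * 2 / sqrt a * inverse (sqrt M)) \<longlongrightarrow> C * 2 / sqrt a * 0) at_top"
      by (intro tendsto_mult tendsto_const tendsto_inverse_0_at_top sqrt_at_top)
    moreover have "\<forall>\<^sub>F M in at_top. C * 2 / sqrt a * inverse (sqrt M) = C * (2 * sqrt (M / a) / M)"
      using eventually_gt_at_top[of 0]
      by eventually_elim (use ab in \<open>simp add: real_sqrt_divide field_simps\<close>)
    ultimately show ?thesis
      by (auto intro: Lim_transform_eventually)
  qed
  have "\<forall>\<^sub>F M in at_top. ((K + a) / M) powr (b / a - 1) < 3 * \<delta> / (1 + 3 * \<delta>)"
    by (rule order_tendstoD(2)[OF lim1]) (use \<delta> in simp)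
  moreover have "\<forall>\<^sub>F M in at_top. M * ((K + a) / M) powr (b / a) / b < \<eta> / 3"
    by (rule order_tendstoD(2)[OF lim2]) (use \<eta> in simp)
  moreover have "\<forall>\<^sub>F M in at_top. C * (2 * sqrt (M / a) / M) < \<eta> / 3"
    by (rule order_tendstoD(2)[OF lim3]) (use \<eta> in simp)
  moreover have "\<forall>\<^sub>F M in at_top. K \<le> M"
    by (rule eventually_ge_at_top)
  ultimately show ?thesis
  proof eventually_elim
    case (elim M)
    show ?case
    proof (intro allI impI)
      fix k :: nat
      assume k: "0 < real k * b" "real k * b < M"
      interpret urn_path a b "real k * b" M
        using ab k by unfold_locales
      interpret prob_space "urn_law a b (real k * b, M - real k * b)" by (rule prob_space_urn_law)
      have slope: "slope = c" by (simp add: slope_def c_def)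
      \<comment> \<open>Three contributions of at most \<open>\<eta> / 3\<close> each. None of them
        involves \<open>k\<close>, which gives uniformity over the starting configurations.\<close>
      have "C * (2 * sqrt (M / a) / M + 2 / K) + M * ((K + a) / M) powr (b / a) / b \<le> \<eta>"
        unfolding distrib_left using elim K(4) by linarith
      then have "1 - \<eta> \<le> prob (urn_L_event a b (real k * b) M (3 * \<delta>))"
        using prob_urn_L_event_ge[OF \<delta>(1,2) K(1) elim(4) refl] K(3) elim(1) unfolding slope C_def by simp
      also have "\<dots> \<le> prob (urn_L_event a b (real k * b) M \<epsilon>)"
        by (rule finite_measure_mono[OF _ urn_L_event_measurable])
          (use \<delta>(3) in \<open>force simp: urn_L_event_def\<close>)
      finally show "1 - \<eta> \<le> prob (urn_L_event a b (real k * b) M \<epsilon>)" .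
    qed
  qed
qed

theorem theorem1p4:
  fixes a b :: real
  assumes "0 < a" and "a < b"
  shows "\<forall>\<epsilon>>0. \<exists>lam :: real \<Rightarrow> real.
    (\<forall>M>b. 0 < lam M) \<and>
    (lam \<longlongrightarrow> 0) at_top \<and>
    (\<forall>M X0. (\<exists>k::nat. 0 < k \<and> X0 = real k * b) \<and> 0 < X0 \<and> X0 < M \<longrightarrow>
       measure (urn_law a b (X0, M - X0)) (urn_L_event a b X0 M \<epsilon>) \<ge> 1 - lam M)"
proof (intro allI impI)
  fix \<epsilon> :: real
  assume \<epsilon>: "0 < \<epsilon>"
  \<comment> \<open>Failure probabilities of all starting configurations with total
    \<open>M\<close>. Inserting 0 keeps the set nonempty when no positive multiple of
    \<open>b\<close> lies below \<open>M\<close>, and its supremum nonnegative.\<close>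
  define F where "F M = insert 0 ((\<lambda>k. 1 - measure (urn_law a b (real k * b, M - real k * b))
    (urn_L_event a b (real k * b) M \<epsilon>)) ` {k. 0 < real k * b \<and> real k * b < M})" for M
  \<comment> \<open>The summand \<open>1 / M\<close> ensures strict positivity for
    \<open>M > b\<close> even if all failure probabilities vanish.\<close>
  define lam where "lam M = Sup (F M) + 1 / M" for M
  have bdd: "bdd_above (F M)" for M
    unfolding F_def by (auto intro!: bdd_aboveI2[of _ _ 1])
  have Sup_nonneg: "0 \<le> Sup (F M)" for M
    by (rule cSup_upper[OF _ bdd]) (simp add: F_def)
  have "0 < lam M" if "b < M" for M
    using Sup_nonneg[of M] that assms by (simp add: lam_def add_nonneg_pos)
  moreover have "(lam \<longlongrightarrow> 0) at_top"
  proof (rule order_tendstoI)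
    fix \<eta> :: real assume "\<eta> < 0"
    show "\<forall>\<^sub>F M in at_top. \<eta> < lam M"
      using eventually_gt_at_top[of 0]
    proof eventually_elim
      case (elim M)
      then have "0 < 1 / M" by simp
      then show ?case
        using Sup_nonneg[of M] \<open>\<eta> < 0\<close> unfolding lam_def by linarith
    qed
  next
    fix \<eta> :: real assume \<eta>: "0 < \<eta>"
    then have "\<forall>\<^sub>F M in at_top. \<forall>k::nat. 0 < real k * b \<longrightarrow> real k * b < M \<longrightarrow>
      1 - \<eta> / 2 \<le> measure (urn_law a b (real k * b, M - real k * b)) (urn_L_event a b (real k * b) M \<epsilon>)"
      using assms \<epsilon> by (intro eventually_urn_L_event_ge) auto
    then show "\<forall>\<^sub>F M in at_top. lam M < \<eta>"
      using eventually_gt_at_top[of "2 / \<eta>"]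
    proof eventually_elim
      case (elim M)
      have "Sup (F M) \<le> \<eta> / 2"
        by (rule cSup_least) (use elim(1) \<eta> in \<open>auto simp: F_def algebra_simps\<close>)
      moreover have "0 < 2 / \<eta>"
        using \<eta> by simp
      then have "0 < M"
        using elim(2) by linarith
      then have "1 / M < \<eta> / 2"
        using elim(2) \<eta> by (simp add: field_simps)
      ultimately show ?case by (simp add: lam_def)
    qed
  qed
  moreover have "measure (urn_law a b (X0, M - X0)) (urn_L_event a b X0 M \<epsilon>) \<ge> 1 - lam M"
    if "(\<exists>k::nat. 0 < k \<and> X0 = real k * b) \<and> 0 < X0 \<and> X0 < M" for M X0
  proof -
    have "1 - measure (urn_law a b (X0, M - X0)) (urn_L_event a b X0 M \<epsilon>) \<le> Sup (F M)"
      by (rule cSup_upper[OF _ bdd]) (use that in \<open>auto simp: F_def\<close>)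
    moreover have "0 < 1 / M" using that by simp
    ultimately show ?thesis unfolding lam_def by linarith
  qed
  ultimately show "\<exists>lam :: real \<Rightarrow> real.
    (\<forall>M>b. 0 < lam M) \<and>
    (lam \<longlongrightarrow> 0) at_top \<and>
    (\<forall>M X0. (\<exists>k::nat. 0 < k \<and> X0 = real k * b) \<and> 0 < X0 \<and> X0 < M \<longrightarrow>
       measure (urn_law a b (X0, M - X0)) (urn_L_event a b X0 M \<epsilon>) \<ge> 1 - lam M)"
    by blast
qed

end
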